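(* (1) Let $T$ be a set of traces over $\mathcal{X}$. For every unconstrained hypertrace formula $\varphi$ over $\mathcal{X}$ and all assignments $\Pi_{\mathbb{T}},\Pi_{\mathbb{N}}$: $(T,(\Pi_{\mathbb{T}},\Pi_{\mathbb{N}}))\models\varphi$ iff $(\Pi_{\mathbb{N}},\mathtt{toSuppSet}(\Pi_{\mathbb{T}}))\models_{\mathrm{S1S}}\mathtt{toS1S}(\varphi,\mathcal{X})$. (2) For every $\mathrm{S1S}$ formula $\varphi$ and all first- and second-order assignments $\Pi_1,\Pi_2$ (and any set of traces $T$): $(\Pi_1,\Pi_2)\models_{\mathrm{S1S}}\varphi$ iff $(T,(\mathtt{toBool}(\Pi_2),\Pi_1))\models\mathtt{toHyper}(\varphi)$.
   Context: Hypertrace logic. Fix a finite set $\mathcal{X}$ of propositional variables; a trace is an infinite sequence of subsets of $\mathcal{X}$, $(2^{\mathcal{X}})^\omega$ the set of all traces, $\tau[k]$ its $k$-th element. Hypertrace formulas over trace variables and disjoint time variables: $\varphi ::= \exists\pi\,\varphi \mid \exists^{T}\pi\,\varphi \mid \exists i\,\varphi \mid \neg\varphi \mid \varphi\vee\varphi \mid i<j \mid i=j \mid x(\pi,i)$, $x\in\mathcal{X}$; usual abbreviations; each variable quantified at most once. For $T\subseteq(2^{\mathcal{X}})^\omega$, trace assignment $\Pi_{\mathbb{T}}$ and time assignment $\Pi_{\mathbb{N}}$: $\exists\pi$ ranges over all of $(2^{\mathcal{X}})^\omega$, $\exists^T\pi$ over $T$, $\exists i$ over $\mathbb{N}$; $i<j,i=j$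 as in $\mathbb{N}$; $x(\pi,i)$ holds iff $x\in\Pi_{\mathbb{T}}(\pi)[\Pi_{\mathbb{N}}(i)]$; this relation is written $(T,(\Pi_{\mathbb{T}},\Pi_{\mathbb{N}}))\models\varphi$. A formula is unconstrained if it contains no constrained quantifier $\exists^T$ (or $\forall^T$). S1S: formulas $\varphi ::= \exists X\,\varphi\mid\exists i\,\varphi\mid\neg\varphi\mid\varphi\vee\varphi\mid i=j\mid \mathrm{Succ}(i,j)\mid X(i)$ with first-order variables $i,j$ and second-order variables $X$, interpreted over $\mathbb{N}$ with a first-order assignment $\Pi_1$ into $\mathbb{N}$ and a second-order assignment $\Pi_2$ into subsets of $\mathbb{N}$; $\exists X$ ranges over subsets of $\mathbb{N}$, $\exists i$ over $\mathbb{N}$, $\mathrm{Succ}(i,j)$ iff $\Pi_1(j)=\Pi_1(i)+1$, $X(i)$ iff $\Pi_1(i)\in\Pi_2(X)$; $i<j$ is the S1S-definable strict order. $\mathtt{flatten}$: with $\mathcal{X}=\{x_0,\dots,x_n\}$ and fresh trace variables $\pi_x$: $\mathtt{flatten}(\exists\pi\,\varphi,\mathcal{X},\mathcal{V})=\exists\pi_{x_0}\cdots\exists\pi_{x_n}\mathtt{flatten}(\varphi,\mathcal{X},\mathcal{V}\cup\{\pi\})$; commutes with $\exists^T\pi$, $\exists i$, $\neg$, $\vee$; leaves $i<j,i=j$ unchanged; maps $x(\pi,i)$ to $x(\pi_x,i)$ if $\pi\in\mathcal{V}$, else unchanged. $\mathtt{toS1S}(\varphi,\mathcal{X})$ is obtained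 from $\mathtt{flatten}(\varphi,\mathcal{X},\mathcal{V}_{\mathbb{T}}\cap\mathrm{free}(\varphi))$ (where $\mathcal{V}_{\mathbb{T}}$ is the set of trace variables) by replacing every atom $x(\pi_x,i)$ with $\pi_x(i)$, reading each trace variable $\pi_x$ as a second-order variable (trace quantifiers become second-order quantifiers) and each time variable as a first-order variable. $\mathtt{toSuppSet}(\Pi_{\mathbb{T}})$ is the second-order assignment with $\mathtt{toSuppSet}(\Pi_{\mathbb{T}})(\pi_x)=\{i\mid x\in\Pi_{\mathbb{T}}(\pi)[i]\}$. $\mathtt{toHyper}$ maps S1S formulas to hypertrace formulas whose propositional variables include the second-order variables: $\mathtt{toHyper}(\exists X\,\varphi)=\exists\pi_X\,\mathtt{toHyper}(\varphi)$, $\mathtt{toHyper}(X(i))=X(\pi_X,i)$, commutes with $\exists i,\neg,\vee$, $\mathtt{toHyper}(i=j)=(i=j)$, $\mathtt{toHyper}(\mathrm{Succ}(i,i'))=i<i'\wedge\forall j\,(i<j\to i'\le j)$ (with $i'\le j$ meaning $i'<j\vee i'=j$). $\mathtt{toBool}(\Pi_2)$ is a trace assignment with $X\in\mathtt{toBool}(\Pi_2)(\pi_X)[i]$ iff $i\in\Pi_2(X)$, for all $i\in\mathbb{N}$ and second-order variables $X$. *)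

theory Defs
  imports Main "HOL-Library.Infinite_Typeclass"
begin

section \<open>Hypertrace logic\<close>

type_synonym 'x trace = "nat \<Rightarrow> 'x set"

definition traces :: "'x set \<Rightarrow> 'x trace set" where
  "traces AP = {\<tau>. \<forall>k. \<tau> k \<subseteq> AP}"

definition trace_assignment :: "'x set \<Rightarrow> ('v \<Rightarrow> 'x trace) \<Rightarrow> bool" where
  "trace_assignment AP \<Pi> \<longleftrightarrow> (\<forall>\<pi>. \<Pi> \<pi> \<in> traces AP)"

text \<open>Trace variables \<open>'v\<close> and time variables \<open>'i\<close> are disjoint because they have different types.
  \<open>HProp x \<pi> i\<close> is the atom \<open>x(\<pi>,i)\<close>, \<open>HExT\<close> is the constrained quantifier.\<close>

datatype ('v, 'i, hprops: 'x) hyper =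
    HEx 'v "('v, 'i, 'x) hyper"
  | HExT 'v "('v, 'i, 'x) hyper"
  | HExTime 'i "('v, 'i, 'x) hyper"
  | HNot "('v, 'i, 'x) hyper"
  | HOr "('v, 'i, 'x) hyper" "('v, 'i, 'x) hyper"
  | HLess 'i 'i
  | HEq 'i 'i
  | HProp 'x 'v 'i

abbreviation HAnd where "HAnd \<phi> \<psi> \<equiv> HNot (HOr (HNot \<phi>) (HNot \<psi>))"
abbreviation HImp where "HImp \<phi> \<psi> \<equiv> HOr (HNot \<phi>) \<psi>"
abbreviation HAllTime where "HAllTime i \<phi> \<equiv> HNot (HExTime i (HNot \<phi>))"
abbreviation HLeq where "HLeq i j \<equiv> HOr (HLess i j) (HEq i j)"

fun bound_traces :: "('v, 'i, 'x) hyper \<Rightarrow> 'v list" where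
  "bound_traces (HEx \<pi> \<phi>) = \<pi> # bound_traces \<phi>"
| "bound_traces (HExT \<pi> \<phi>) = \<pi> # bound_traces \<phi>"
| "bound_traces (HExTime i \<phi>) = bound_traces \<phi>"
| "bound_traces (HNot \<phi>) = bound_traces \<phi>"
| "bound_traces (HOr \<phi> \<psi>) = bound_traces \<phi> @ bound_traces \<psi>"
| "bound_traces _ = []"

fun bound_times :: "('v, 'i, 'x) hyper \<Rightarrow> 'i list" where
  "bound_times (HEx \<pi> \<phi>) = bound_times \<phi>"
| "bound_times (HExT \<pi> \<phi>) = bound_times \<phi>"
| "bound_times (HExTime i \<phi>) = i # bound_times \<phi>"
| "bound_times (HNot \<phi>) = bound_times \<phi>"
| "bound_times (HOr \<phi> \<psi>) = bound_times \<phi> @ bound_times \<psi>"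
| "bound_times _ = []"

text \<open>Formulas over the propositions \<open>AP\<close>, with each variable quantified at most once.\<close>

definition hyper_formula :: "'x set \<Rightarrow> ('v, 'i, 'x) hyper \<Rightarrow> bool" where
  "hyper_formula AP \<phi> \<longleftrightarrow>
     hprops \<phi> \<subseteq> AP \<and> distinct (bound_traces \<phi>) \<and> distinct (bound_times \<phi>)"

fun free_traces :: "('v, 'i, 'x) hyper \<Rightarrow> 'v set" where
  "free_traces (HEx \<pi> \<phi>) = free_traces \<phi> - {\<pi>}"
| "free_traces (HExT \<pi> \<phi>) = free_traces \<phi> - {\<pi>}"
| "free_traces (HExTime i \<phi>) = free_traces \<phi>"
| "free_traces (HNot \<phi>) = free_traces \<phi>"
| "free_traces (HOr \<phi> \<psi>) = free_traces \<phi> \<union> free_traces \<psi>"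
| "free_traces (HLess i j) = {}"
| "free_traces (HEq i j) = {}"
| "free_traces (HProp x \<pi> i) = {\<pi>}"

fun unconstrained :: "('v, 'i, 'x) hyper \<Rightarrow> bool" where
  "unconstrained (HEx \<pi> \<phi>) \<longleftrightarrow> unconstrained \<phi>"
| "unconstrained (HExT \<pi> \<phi>) \<longleftrightarrow> False"
| "unconstrained (HExTime i \<phi>) \<longleftrightarrow> unconstrained \<phi>"
| "unconstrained (HNot \<phi>) \<longleftrightarrow> unconstrained \<phi>"
| "unconstrained (HOr \<phi> \<psi>) \<longleftrightarrow> unconstrained \<phi> \<and> unconstrained \<psi>"
| "unconstrained _ \<longleftrightarrow> True"

fun hyper_sat ::
  "'x set \<Rightarrow> 'x trace set \<Rightarrow> ('v \<Rightarrow> 'x trace) \<Rightarrow> ('i \<Rightarrow> nat) \<Rightarrow> ('v, 'i, 'x) hyper \<Rightarrow> bool" where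
  "hyper_sat AP T \<Pi>T \<Pi>N (HEx \<pi> \<phi>) \<longleftrightarrow> (\<exists>\<tau>\<in>traces AP. hyper_sat AP T (\<Pi>T(\<pi> := \<tau>)) \<Pi>N \<phi>)"
| "hyper_sat AP T \<Pi>T \<Pi>N (HExT \<pi> \<phi>) \<longleftrightarrow> (\<exists>\<tau>\<in>T. hyper_sat AP T (\<Pi>T(\<pi> := \<tau>)) \<Pi>N \<phi>)"
| "hyper_sat AP T \<Pi>T \<Pi>N (HExTime i \<phi>) \<longleftrightarrow> (\<exists>k. hyper_sat AP T \<Pi>T (\<Pi>N(i := k)) \<phi>)"
| "hyper_sat AP T \<Pi>T \<Pi>N (HNot \<phi>) \<longleftrightarrow> \<not> hyper_sat AP T \<Pi>T \<Pi>N \<phi>"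
| "hyper_sat AP T \<Pi>T \<Pi>N (HOr \<phi> \<psi>) \<longleftrightarrow> hyper_sat AP T \<Pi>T \<Pi>N \<phi> \<or> hyper_sat AP T \<Pi>T \<Pi>N \<psi>"
| "hyper_sat AP T \<Pi>T \<Pi>N (HLess i j) \<longleftrightarrow> \<Pi>N i < \<Pi>N j"
| "hyper_sat AP T \<Pi>T \<Pi>N (HEq i j) \<longleftrightarrow> \<Pi>N i = \<Pi>N j"
| "hyper_sat AP T \<Pi>T \<Pi>N (HProp x \<pi> i) \<longleftrightarrow> x \<in> \<Pi>T \<pi> (\<Pi>N i)"


section \<open>S1S\<close>

datatype (so_vars: 's, 'i) s1s =
    SEx2 's "('s, 'i) s1s"
  | SEx1 'i "('s, 'i) s1s"
  | SNot "('s, 'i) s1s"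
  | SOr "('s, 'i) s1s" "('s, 'i) s1s"
  | SEq 'i 'i
  | SSucc 'i 'i
  | SMem 's 'i

abbreviation SAnd where "SAnd \<phi> \<psi> \<equiv> SNot (SOr (SNot \<phi>) (SNot \<psi>))"
abbreviation SImp where "SImp \<phi> \<psi> \<equiv> SOr (SNot \<phi>) \<psi>"
abbreviation SAll1 where "SAll1 i \<phi> \<equiv> SNot (SEx1 i (SNot \<phi>))"
abbreviation SAll2 where "SAll2 X \<phi> \<equiv> SNot (SEx2 X (SNot \<phi>))"

fun s1s_sat :: "('i \<Rightarrow> nat) \<Rightarrow> ('s \<Rightarrow> nat set) \<Rightarrow> ('s, 'i) s1s \<Rightarrow> bool" where
  "s1s_sat \<Pi>1 \<Pi>2 (SEx2 X \<phi>) \<longleftrightarrow> (\<exists>A. s1s_sat \<Pi>1 (\<Pi>2(X := A)) \<phi>)"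
| "s1s_sat \<Pi>1 \<Pi>2 (SEx1 i \<phi>) \<longleftrightarrow> (\<exists>k. s1s_sat (\<Pi>1(i := k)) \<Pi>2 \<phi>)"
| "s1s_sat \<Pi>1 \<Pi>2 (SNot \<phi>) \<longleftrightarrow> \<not> s1s_sat \<Pi>1 \<Pi>2 \<phi>"
| "s1s_sat \<Pi>1 \<Pi>2 (SOr \<phi> \<psi>) \<longleftrightarrow> s1s_sat \<Pi>1 \<Pi>2 \<phi> \<or> s1s_sat \<Pi>1 \<Pi>2 \<psi>"
| "s1s_sat \<Pi>1 \<Pi>2 (SEq i j) \<longleftrightarrow> \<Pi>1 i = \<Pi>1 j"
| "s1s_sat \<Pi>1 \<Pi>2 (SSucc i j) \<longleftrightarrow> \<Pi>1 j = \<Pi>1 i + 1"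
| "s1s_sat \<Pi>1 \<Pi>2 (SMem X i) \<longleftrightarrow> \<Pi>1 i \<in> \<Pi>2 X"

definition fresh :: "'a::infinite set \<Rightarrow> 'a" where
  "fresh A = (SOME a. a \<notin> A)"

lemma fresh_notin: "finite A \<Longrightarrow> fresh A \<notin> A"
  unfolding fresh_def by (rule someI_ex) (rule ex_new_if_finite[OF infinite_UNIV])

text \<open>The order is not primitive in S1S: \<open>i < j\<close> says that \<open>j\<close> belongs to every successor-closed
  set \<open>X\<close> containing the successor of \<open>i\<close>. Any variable can serve as \<open>X\<close>, which is bound.\<close>

definition SLess :: "'s \<Rightarrow> 'i::infinite \<Rightarrow> 'i \<Rightarrow> ('s, 'i) s1s" where
  "SLess X i j =
     (let k = fresh {i, j}; l = fresh {i, j, k} in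
      SAll2 X
       (SImp
         (SAnd (SAll1 k (SImp (SSucc i k) (SMem X k)))
               (SAll1 k (SAll1 l (SImp (SAnd (SMem X k) (SSucc k l)) (SMem X l)))))
         (SMem X j)))"

lemma s1s_sat_SLess: "s1s_sat \<Pi>1 \<Pi>2 (SLess X i j) \<longleftrightarrow> \<Pi>1 i < \<Pi>1 j"
proof -
  define k where "k = fresh {i, j}"
  define l where "l = fresh {i, j, k}"
  have k: "k \<noteq> i" "k \<noteq> j" using fresh_notin[of "{i, j}"] by (auto simp: k_def)
  have l: "l \<noteq> i" "l \<noteq> j" "l \<noteq> k" using fresh_notin[of "{i, j, k}"] by (auto simp: l_def)
  have "s1s_sat \<Pi>1 \<Pi>2 (SLess X i j) \<longleftrightarrow>
     (\<forall>A. Suc (\<Pi>1 i) \<in> A \<and> (\<forall>n. n \<in> A \<longrightarrow> Suc n \<in> A) \<longrightarrow> \<Pi>1 j \<in> A)"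
    unfolding SLess_def Let_def k_def[symmetric] l_def[symmetric]
    using k l by (simp, blast)
  also have "\<dots> \<longleftrightarrow> \<Pi>1 i < \<Pi>1 j"
  proof
    assume "\<forall>A. Suc (\<Pi>1 i) \<in> A \<and> (\<forall>n. n \<in> A \<longrightarrow> Suc n \<in> A) \<longrightarrow> \<Pi>1 j \<in> A"
    from this[rule_format, of "{\<Pi>1 i<..}"] show "\<Pi>1 i < \<Pi>1 j" by auto
  next
    assume "\<Pi>1 i < \<Pi>1 j"
    then have "Suc (\<Pi>1 i) \<le> \<Pi>1 j" by simp
    then show "\<forall>A. Suc (\<Pi>1 i) \<in> A \<and> (\<forall>n. n \<in> A \<longrightarrow> Suc n \<in> A) \<longrightarrow> \<Pi>1 j \<in> A"
      by (induction rule: dec_induct) auto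
  qed
  finally show ?thesis .
qed


section \<open>From hypertrace logic to S1S\<close>

text \<open>Variables of flattened formulas: an original trace variable \<open>\<pi>\<close>, or the fresh variable
  \<open>\<pi>\<^sub>x\<close>, written \<open>Comp \<pi> x\<close>. \<open>Aux\<close> does not occur in flattened formulas; it is the bound
  second-order variable of \<open>SLess\<close>.\<close>

datatype ('v, 'x) fvar = Orig 'v | Comp 'v 'x | Aux

text \<open>The finite set of propositions is given by an enumeration \<open>xs\<close>.\<close>

fun flatten :: "'x list \<Rightarrow> 'v set \<Rightarrow> ('v, 'i, 'x) hyper \<Rightarrow> (('v, 'x) fvar, 'i, 'x) hyper" where
  "flatten xs V (HEx \<pi> \<phi>) = foldr (\<lambda>x. HEx (Comp \<pi> x)) xs (flatten xs (V \<union> {\<pi>}) \<phi>)"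
| "flatten xs V (HExT \<pi> \<phi>) = HExT (Orig \<pi>) (flatten xs V \<phi>)"
| "flatten xs V (HExTime i \<phi>) = HExTime i (flatten xs V \<phi>)"
| "flatten xs V (HNot \<phi>) = HNot (flatten xs V \<phi>)"
| "flatten xs V (HOr \<phi> \<psi>) = HOr (flatten xs V \<phi>) (flatten xs V \<psi>)"
| "flatten xs V (HLess i j) = HLess i j"
| "flatten xs V (HEq i j) = HEq i j"
| "flatten xs V (HProp x \<pi> i) = HProp x (if \<pi> \<in> V then Comp \<pi> x else Orig \<pi>) i"

text \<open>Only the image of unconstrained formulas matters: their flattenings contain no \<open>HExT\<close>, and
  all their atoms have the form \<open>HProp x (Comp \<pi> x) i\<close>.\<close>

fun read_s1s :: "(('v, 'x) fvar, 'i::infinite, 'x) hyper \<Rightarrow> (('v, 'x) fvar, 'i) s1s" where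
  "read_s1s (HEx p \<phi>) = SEx2 p (read_s1s \<phi>)"
| "read_s1s (HExT p \<phi>) = SEx2 p (read_s1s \<phi>)"
| "read_s1s (HExTime i \<phi>) = SEx1 i (read_s1s \<phi>)"
| "read_s1s (HNot \<phi>) = SNot (read_s1s \<phi>)"
| "read_s1s (HOr \<phi> \<psi>) = SOr (read_s1s \<phi>) (read_s1s \<psi>)"
| "read_s1s (HLess i j) = SLess Aux i j"
| "read_s1s (HEq i j) = SEq i j"
| "read_s1s (HProp x p i) = SMem p i"

definition toS1S :: "('v, 'i::infinite, 'x) hyper \<Rightarrow> 'x list \<Rightarrow> (('v, 'x) fvar, 'i) s1s" where
  "toS1S \<phi> xs = read_s1s (flatten xs (free_traces \<phi>) \<phi>)"

fun toSuppSet :: "('v \<Rightarrow> 'x trace) \<Rightarrow> ('v, 'x) fvar \<Rightarrow> nat set" where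
  "toSuppSet \<Pi> (Comp \<pi> x) = {i. x \<in> \<Pi> \<pi> i}"
| "toSuppSet \<Pi> _ = undefined"


section \<open>From S1S to hypertrace logic\<close>

text \<open>\<open>TVar X\<close> is the trace variable \<open>\<pi>\<^sub>X\<close>.\<close>

datatype 's tvar = TVar 's

fun toHyper :: "('s, 'i::infinite) s1s \<Rightarrow> ('s tvar, 'i, 's) hyper" where
  "toHyper (SEx2 X \<phi>) = HEx (TVar X) (toHyper \<phi>)"
| "toHyper (SEx1 i \<phi>) = HExTime i (toHyper \<phi>)"
| "toHyper (SNot \<phi>) = HNot (toHyper \<phi>)"
| "toHyper (SOr \<phi> \<psi>) = HOr (toHyper \<phi>) (toHyper \<psi>)"
| "toHyper (SEq i j) = HEq i j"
| "toHyper (SSucc i i') =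
     (let j = fresh {i, i'} in HAnd (HLess i i') (HAllTime j (HImp (HLess i j) (HLeq i' j))))"
| "toHyper (SMem X i) = HProp X (TVar X) i"

text \<open>The value of \<open>toBool\<close> is determined only up to the propositions other than \<open>X\<close> on the trace
  of \<open>\<pi>\<^sub>X\<close>, so it is a relation. \<open>S\<close> is the set of second-order variables, \<open>AP\<close> that of
  propositions, with \<open>S \<subseteq> AP\<close>.\<close>

definition is_toBool ::
  "'s set \<Rightarrow> 's set \<Rightarrow> ('s \<Rightarrow> nat set) \<Rightarrow> ('s tvar \<Rightarrow> 's trace) \<Rightarrow> bool" where
  "is_toBool S AP \<Pi>2 \<Pi> \<longleftrightarrow>
     trace_assignment AP \<Pi> \<and> (\<forall>X\<in>S. \<forall>i. X \<in> \<Pi> (TVar X) i \<longleftrightarrow> i \<in> \<Pi>2 X)"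

lemma ex_is_toBool:
  assumes "S \<subseteq> AP"
  shows "\<exists>\<Pi>. is_toBool S AP \<Pi>2 \<Pi>"
proof
  show "is_toBool S AP \<Pi>2 (\<lambda>p i. {X \<in> S. i \<in> \<Pi>2 X})"
    using assms by (auto simp: is_toBool_def trace_assignment_def traces_def)
qed

end

theory Submission
  imports Defs
begin

text \<open>Turns a block of nested set quantifiers into a single choice of an assignment that is
  free on the block and fixed elsewhere. A trace quantifier flattens to such a block, so all its
  components can be given at once.\<close>

lemma s1s_sat_foldr_SEx2:
  "s1s_sat \<Pi>1 \<Pi>2 (foldr SEx2 Xs \<phi>) \<longleftrightarrow>
     (\<exists>\<Pi>2'. (\<forall>X. X \<notin> set Xs \<longrightarrow> \<Pi>2' X = \<Pi>2 X) \<and> s1s_sat \<Pi>1 \<Pi>2' \<phi>)"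
proof (induction Xs arbitrary: \<Pi>2)
  case Nil
  have "(\<forall>X. \<Pi>2' X = \<Pi>2 X) \<longleftrightarrow> \<Pi>2' = \<Pi>2" for \<Pi>2'
    by auto
  then show ?case by simp
next
  case (Cons Y Xs)
  have upd: "(\<exists>A. \<forall>X. X \<notin> set Xs \<longrightarrow> \<Pi>2' X = (\<Pi>2(Y := A)) X) \<longleftrightarrow>
      (\<forall>X. X \<notin> set (Y # Xs) \<longrightarrow> \<Pi>2' X = \<Pi>2 X)" for \<Pi>2'
  proof
    assume "\<forall>X. X \<notin> set (Y # Xs) \<longrightarrow> \<Pi>2' X = \<Pi>2 X"
    then show "\<exists>A. \<forall>X. X \<notin> set Xs \<longrightarrow> \<Pi>2' X = (\<Pi>2(Y := A)) X"
      by (intro exI[of _ "\<Pi>2' Y"]) auto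
  qed auto
  have "s1s_sat \<Pi>1 \<Pi>2 (foldr SEx2 (Y # Xs) \<phi>) \<longleftrightarrow>
      (\<exists>A \<Pi>2'. (\<forall>X. X \<notin> set Xs \<longrightarrow> \<Pi>2' X = (\<Pi>2(Y := A)) X) \<and> s1s_sat \<Pi>1 \<Pi>2' \<phi>)"
    by (simp only: foldr.simps o_apply s1s_sat.simps Cons.IH)
  also have "\<dots> \<longleftrightarrow>
      (\<exists>\<Pi>2'. (\<exists>A. \<forall>X. X \<notin> set Xs \<longrightarrow> \<Pi>2' X = (\<Pi>2(Y := A)) X) \<and> s1s_sat \<Pi>1 \<Pi>2' \<phi>)"
    by (subst ex_comm) (simp only: ex_simps)
  finally show ?case
    unfolding upd .
qed

lemma read_s1s_foldr_HEx:
  "read_s1s (foldr (\<lambda>x. HEx (f x)) xs \<psi>) = foldr SEx2 (map f xs) (read_s1s \<psi>)"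
  by (induction xs) auto

text \<open>Unlike \<^const>\<open>toSuppSet\<close>, the relation between the assignments constrains only the components
  in \<open>xs\<close>, since the flattened quantifiers leave all others unchanged.\<close>

lemma hyper_sat_iff_s1s_sat_flatten:
  fixes \<phi> :: "('v, 'i::infinite, 'x) hyper"
  assumes "unconstrained \<phi>" "hprops \<phi> \<subseteq> set xs" "free_traces \<phi> \<subseteq> V"
    and "\<And>\<pi> x. x \<in> set xs \<Longrightarrow> \<Pi>2 (Comp \<pi> x) = {i. x \<in> \<Pi>T \<pi> i}"
  shows "hyper_sat (set xs) T \<Pi>T \<Pi>N \<phi> \<longleftrightarrow> s1s_sat \<Pi>N \<Pi>2 (read_s1s (flatten xs V \<phi>))"
  using assms
proof (induction \<phi> arbitrary: V \<Pi>T \<Pi>N \<Pi>2)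
  case (HEx \<pi> \<phi>)
  note IH = HEx.IH[of "V \<union> {\<pi>}"]
  have hyps: "unconstrained \<phi>" "hprops \<phi> \<subseteq> set xs" "free_traces \<phi> \<subseteq> V \<union> {\<pi>}"
    using HEx.prems by auto
  let ?Q = "\<lambda>\<Pi>2'. (\<forall>p. p \<notin> Comp \<pi> ` set xs \<longrightarrow> \<Pi>2' p = \<Pi>2 p) \<and>
    s1s_sat \<Pi>N \<Pi>2' (read_s1s (flatten xs (V \<union> {\<pi>}) \<phi>))"
  have "(\<exists>\<tau>\<in>traces (set xs). hyper_sat (set xs) T (\<Pi>T(\<pi> := \<tau>)) \<Pi>N \<phi>) \<longleftrightarrow> (\<exists>\<Pi>2'. ?Q \<Pi>2')"
  proof
    assume "\<exists>\<tau>\<in>traces (set xs). hyper_sat (set xs) T (\<Pi>T(\<pi> := \<tau>)) \<Pi>N \<phi>"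
    then obtain \<tau> where \<tau>: "hyper_sat (set xs) T (\<Pi>T(\<pi> := \<tau>)) \<Pi>N \<phi>"
      by blast
    \<comment> \<open>Inside the block the components come from \<open>\<tau>\<close>; outside it
      \<open>\<Pi>2\<close> is kept, as the quantifier block demands. \<open>toSuppSet\<close> is
      applied only to \<open>Comp\<close> variables, so its undefined values never enter.\<close>
    define \<Pi>2' where
      "\<Pi>2' = (\<lambda>p. if p \<in> Comp \<pi> ` set xs then toSuppSet (\<Pi>T(\<pi> := \<tau>)) p else \<Pi>2 p)"
    have "\<Pi>2' (Comp \<rho> x) = {i. x \<in> (\<Pi>T(\<pi> := \<tau>)) \<rho> i}" if "x \<in> set xs" for \<rho> x
      using HEx.prems(4)[OF that] that by (auto simp: \<Pi>2'_def)
    then have "s1s_sat \<Pi>N \<Pi>2' (read_s1s (flatten xs (V \<union> {\<pi>}) \<phi>))"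
      using IH[OF hyps] \<tau> by blast
    then have "?Q \<Pi>2'"
      by (simp add: \<Pi>2'_def)
    then show "\<exists>\<Pi>2'. ?Q \<Pi>2'" by (rule exI[of ?Q])
  next
    assume "\<exists>\<Pi>2'. ?Q \<Pi>2'"
    then obtain \<Pi>2' where Q: "?Q \<Pi>2'" by (rule exE)
    \<comment> \<open>The chosen component sets are reassembled into one trace; restricting to
      \<open>set xs\<close> makes it a trace over the propositions.\<close>
    define \<tau> where "\<tau> = (\<lambda>i. {x \<in> set xs. i \<in> \<Pi>2' (Comp \<pi> x)})"
    have "\<Pi>2' (Comp \<rho> x) = \<Pi>2 (Comp \<rho> x)" if "\<rho> \<noteq> \<pi>" for \<rho> x
      using Q that by blast
    then have "\<Pi>2' (Comp \<rho> x) = {i. x \<in> (\<Pi>T(\<pi> := \<tau>)) \<rho> i}" if "x \<in> set xs" for \<rho> x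
      using HEx.prems(4)[OF that] that by (simp add: \<tau>_def)
    then have "hyper_sat (set xs) T (\<Pi>T(\<pi> := \<tau>)) \<Pi>N \<phi>"
      using IH[OF hyps] Q by blast
    moreover have "\<tau> \<in> traces (set xs)"
      by (auto simp: \<tau>_def traces_def)
    ultimately show "\<exists>\<tau>\<in>traces (set xs). hyper_sat (set xs) T (\<Pi>T(\<pi> := \<tau>)) \<Pi>N \<phi>" ..
  qed
  then show ?case
    by (simp add: read_s1s_foldr_HEx s1s_sat_foldr_SEx2)
next
  case (HExT \<pi> \<phi>)
  then show ?case by simp
next
  case (HExTime i \<phi>)
  have "hyper_sat (set xs) T \<Pi>T (\<Pi>N(i := k)) \<phi> \<longleftrightarrow>
      s1s_sat (\<Pi>N(i := k)) \<Pi>2 (read_s1s (flatten xs V \<phi>))" for k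
    using HExTime.prems by (intro HExTime.IH) auto
  then show ?case by simp
next
  case (HNot \<phi>)
  have "hyper_sat (set xs) T \<Pi>T \<Pi>N \<phi> \<longleftrightarrow> s1s_sat \<Pi>N \<Pi>2 (read_s1s (flatten xs V \<phi>))"
    using HNot.prems by (intro HNot.IH) auto
  then show ?case by simp
next
  case (HOr \<phi> \<psi>)
  have "hyper_sat (set xs) T \<Pi>T \<Pi>N \<phi> \<longleftrightarrow> s1s_sat \<Pi>N \<Pi>2 (read_s1s (flatten xs V \<phi>))"
    using HOr.prems by (intro HOr.IH(1)) auto
  moreover have "hyper_sat (set xs) T \<Pi>T \<Pi>N \<psi> \<longleftrightarrow> s1s_sat \<Pi>N \<Pi>2 (read_s1s (flatten xs V \<psi>))"
    using HOr.prems by (intro HOr.IH(2)) auto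
  ultimately show ?case by simp
\<comment> \<open>For an atom \<open>HProp x \<pi> i\<close>, the bound on the free traces gives
  \<open>\<pi> \<in> V\<close>, so flattening yields \<open>Comp \<pi> x\<close>, and
  \<open>x \<in> set xs\<close> makes the assumption on \<open>\<Pi>2\<close> applicable.\<close>
qed (auto simp: s1s_sat_SLess)

text \<open>Each second-order variable has its own trace variable, so replacing the trace of
  \<open>X\<close> leaves the encoding of every other set intact.\<close>

lemma is_toBool_upd:
  assumes "is_toBool S AP \<Pi>2 \<Pi>" "\<tau> \<in> traces AP" "\<And>i. X \<in> \<tau> i \<longleftrightarrow> i \<in> A"
  shows "is_toBool S AP (\<Pi>2(X := A)) (\<Pi>(TVar X := \<tau>))"
  using assms by (auto simp: is_toBool_def trace_assignment_def)

text \<open>The successor is the least number strictly above; freshness of the bound variable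
  prevents capture of \<open>i\<close> and \<open>i'\<close>.\<close>

lemma hyper_sat_toHyper_SSucc:
  "hyper_sat AP T \<Pi> \<Pi>1 (toHyper (SSucc i i')) \<longleftrightarrow> \<Pi>1 i' = \<Pi>1 i + 1"
proof -
  define j where "j = fresh {i, i'}"
  have j: "j \<noteq> i" "j \<noteq> i'"
    using fresh_notin[of "{i, i'}"] by (auto simp: j_def)
  have "hyper_sat AP T \<Pi> \<Pi>1 (toHyper (SSucc i i')) \<longleftrightarrow>
      \<Pi>1 i < \<Pi>1 i' \<and> (\<forall>k. \<Pi>1 i < k \<longrightarrow> \<Pi>1 i' \<le> k)"
    using j by (auto simp: Let_def j_def[symmetric] le_less)
  \<comment> \<open>The upper bound comes from the instance \<open>k = \<Pi>1 i + 1\<close>, the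
    lower bound from strictness.\<close>
  also have "\<dots> \<longleftrightarrow> \<Pi>1 i' = \<Pi>1 i + 1"
    by (auto intro!: antisym)
  finally show ?thesis .
qed

text \<open>The relation \<open>is_toBool\<close> is the induction invariant: a quantified trace may
  carry arbitrary further propositions, so a fixed encoding function would not survive a
  quantifier.\<close>

lemma s1s_sat_iff_hyper_sat_toHyper:
  assumes "so_vars \<phi> \<subseteq> S" "S \<subseteq> AP" "is_toBool S AP \<Pi>2 \<Pi>"
  shows "s1s_sat \<Pi>1 \<Pi>2 \<phi> \<longleftrightarrow> hyper_sat AP T \<Pi> \<Pi>1 (toHyper \<phi>)"
  using assms(1,3)
proof (induction \<phi> arbitrary: \<Pi>1 \<Pi>2 \<Pi>)
  case (SEx2 X \<phi>)
  have vars: "so_vars \<phi> \<subseteq> S"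
    using SEx2.prems by simp
  show ?case
  proof
    assume "s1s_sat \<Pi>1 \<Pi>2 (SEx2 X \<phi>)"
    then obtain A where A: "s1s_sat \<Pi>1 (\<Pi>2(X := A)) \<phi>"
      by auto
    \<comment> \<open>The characteristic trace of \<open>A\<close>; it is a trace over
      \<open>AP\<close> because \<open>X\<close> occurs in the formula and hence lies in
      \<open>S \<subseteq> AP\<close>.\<close>
    define \<tau> where "\<tau> = (\<lambda>i. if i \<in> A then {X} else {})"
    have \<tau>: "\<tau> \<in> traces AP"
      using SEx2.prems assms(2) by (auto simp: \<tau>_def traces_def)
    have "is_toBool S AP (\<Pi>2(X := A)) (\<Pi>(TVar X := \<tau>))"
      using SEx2.prems(2) \<tau> by (rule is_toBool_upd) (simp add: \<tau>_def)
    then show "hyper_sat AP T \<Pi> \<Pi>1 (toHyper (SEx2 X \<phi>))"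
      using SEx2.IH[OF vars] A \<tau> by auto
  next
    assume "hyper_sat AP T \<Pi> \<Pi>1 (toHyper (SEx2 X \<phi>))"
    then obtain \<tau> where \<tau>: "\<tau> \<in> traces AP" "hyper_sat AP T (\<Pi>(TVar X := \<tau>)) \<Pi>1 (toHyper \<phi>)"
      by auto
    \<comment> \<open>The witness set records only where \<open>X\<close> holds on
      \<open>\<tau>\<close>; its other propositions are discarded.\<close>
    have "is_toBool S AP (\<Pi>2(X := {i. X \<in> \<tau> i})) (\<Pi>(TVar X := \<tau>))"
      using SEx2.prems(2) \<tau>(1) by (rule is_toBool_upd) simp
    then show "s1s_sat \<Pi>1 \<Pi>2 (SEx2 X \<phi>)"
      using SEx2.IH[OF vars] \<tau>(2) by auto
  qed
next
  case (SSucc i j)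
  then show ?case
    unfolding hyper_sat_toHyper_SSucc by simp
qed (auto simp: is_toBool_def)

theorem theorem3:
  shows
    "(\<forall>(xs :: 'x list) (T :: 'x trace set) (\<phi> :: ('v, 'i::infinite, 'x) hyper) \<Pi>T \<Pi>N.
        distinct xs \<longrightarrow> T \<subseteq> traces (set xs) \<longrightarrow>
        hyper_formula (set xs) \<phi> \<longrightarrow> unconstrained \<phi> \<longrightarrow>
        trace_assignment (set xs) \<Pi>T \<longrightarrow>
        (hyper_sat (set xs) T \<Pi>T \<Pi>N \<phi> \<longleftrightarrow> s1s_sat \<Pi>N (toSuppSet \<Pi>T) (toS1S \<phi> xs)))
     \<and>
     (\<forall>(S :: 's set) (AP :: 's set) (T :: 's trace set) (\<phi> :: ('s, 'i::infinite) s1s) \<Pi>1 \<Pi>2 \<Pi>B.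
        so_vars \<phi> \<subseteq> S \<longrightarrow> S \<subseteq> AP \<longrightarrow> T \<subseteq> traces AP \<longrightarrow>
        is_toBool S AP \<Pi>2 \<Pi>B \<longrightarrow>
        (s1s_sat \<Pi>1 \<Pi>2 \<phi> \<longleftrightarrow> hyper_sat AP T \<Pi>B \<Pi>1 (toHyper \<phi>)))"
proof (intro conjI allI impI, goal_cases)
  case (1 xs T \<phi> \<Pi>T \<Pi>N)
  then show ?case
    \<comment> \<open>The general statement is used with \<open>V\<close> the free trace variables,
      for which \<open>toSuppSet\<close> gives the required component sets by definition.\<close>
    unfolding toS1S_def hyper_formula_def
    by (intro hyper_sat_iff_s1s_sat_flatten) auto
next
  case (2 S AP T \<phi> \<Pi>1 \<Pi>2 \<Pi>B)
  then show ?case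
    by (intro s1s_sat_iff_hyper_sat_toHyper)
qed

end
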